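(* Let $A\in \mathbb{C}^{n\times n}$, let $k$ be an integer with $0\leq k\leq n$, and let the Hermitian matrix $S(A)=\frac{1}{2i}(A-A^* )$ have eigendecomposition $S(A)=UDU^*$ with $U$ unitary and $D=\operatorname{diag}(\lambda_1,\dots,\lambda_n)$, where the eigenvalues are ordered as $\lambda_1\ge \cdots\ge \lambda_{k_+}> 0$, $\lambda_{k_++1}= \cdots= \lambda_{n-k_-}=0$ and $0> \lambda_{n-k_-+1} \ge \cdots \ge \lambda_{n}$; here $k_+$ is the number of eigenvalues strictly greater than $0$ and $k_-$ the number of eigenvalues strictly smaller than $0$. Let $\hat A = A- i\, U (D-\hat D) U^*$, where $\hat D$ is the diagonal matrix with diagonal elements \[ \hat d_i=\begin{cases} 0 & \text{if } k< i\le k_+ \text{ or } n-k_-< i\le n-k, \\ \lambda_i & \text{otherwise.} \end{cases} \] Then $\hat A\in\mathcal{H}_k$ attains the minimum of $\|A-X\|_F$ over $X\in\mathcal{H}_k$, that is, \[ \min_{X\in \mathcal{H}_k}\|A-X\|_F=\|A-\hat A\|_F . \]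
   Context: $\mathcal{H}_k$ is the set of Hermitian-plus-rank-$k$ matrices: $X\in\mathbb{C}^{n\times n}$ belongs to $\mathcal{H}_k$ if and only if there exist a Hermitian matrix $H\in\mathbb{C}^{n\times n}$ and matrices $G,B\in\mathbb{C}^{n\times k}$ such that $X = H + GB^*$. $\|\cdot\|_F$ is the Frobenius norm. The scalar factor $i$ in $\frac{1}{2i}$ and in the definition of $\hat A$ is the imaginary unit. Eigenvalues are counted with multiplicity. *)

theory Defs
  imports "Jordan_Normal_Form.Schur_Decomposition"
begin

definition hermitian_mat :: "complex mat \<Rightarrow> bool" where
  "hermitian_mat H \<longleftrightarrow> mat_adjoint H = H"

definition unitary_mat :: "complex mat \<Rightarrow> bool" where
  "unitary_mat U \<longleftrightarrow>
     square_mat U \<and> inverts_mat U (mat_adjoint U) \<and> inverts_mat (mat_adjoint U) U"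

definition frobenius_norm :: "complex mat \<Rightarrow> real" where
  "frobenius_norm M = sqrt (\<Sum>i<dim_row M. \<Sum>j<dim_col M. (cmod (M $$ (i, j)))\<^sup>2)"

definition hermitian_plus_rank :: "nat \<Rightarrow> nat \<Rightarrow> complex mat set" where
  "hermitian_plus_rank n k =
     {X. \<exists>H G B. H \<in> carrier_mat n n \<and> hermitian_mat H \<and>
            G \<in> carrier_mat n k \<and> B \<in> carrier_mat n k \<and> X = H + G * mat_adjoint B}"

definition skew_part :: "complex mat \<Rightarrow> complex mat" where
  "skew_part A = (1 / (2 * \<i>)) \<cdot>\<^sub>m (A - mat_adjoint A)"

(* Diagonal entries are indexed from 1 to n, whereas matrix positions start at 0. *)
definition real_diag :: "nat \<Rightarrow> (nat \<Rightarrow> real) \<Rightarrow> complex mat" where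
  "real_diag n d = mk_diagonal (map (\<lambda>i. complex_of_real (d i)) [1..<Suc n])"

lemma mk_diagonal_index:
  "i < length as \<Longrightarrow> j < length as \<Longrightarrow> mk_diagonal as $$ (i, j) = (if i = j then as ! i else 0)"
proof (induction as arbitrary: i j)
  case Nil
  then show ?case by simp
next
  case (Cons a as)
  let ?B = "mk_diagonal as" and ?n = "length as"
  have eq: "mk_diagonal (a # as) =
      four_block_mat (mat 1 1 (\<lambda>_. a)) (0\<^sub>m 1 ?n) (0\<^sub>m ?n 1) ?B"
    using mk_diagonal_dim[of as] by (simp add: mk_diagonal_def Let_def)
  have "mk_diagonal (a # as) $$ (i, j) =
      (if i < 1 then if j < 1 then a else 0 else if j < 1 then 0 else ?B $$ (i - 1, j - 1))"
    unfolding eq using Cons.prems mk_diagonal_dim[of as]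
    by (subst index_mat_four_block(1)) auto
  then show ?case
    using Cons.prems Cons.IH[of "i - 1" "j - 1"] by (cases i; cases j) simp_all
qed

lemma real_diag_carrier [simp]: "real_diag n d \<in> carrier_mat n n"
  unfolding real_diag_def by (rule carrier_matI)
    (simp_all only: mk_diagonal_dim length_map length_upt diff_Suc_1 One_nat_def)

lemma real_diag_index:
  assumes "i < n" "j < n"
  shows "real_diag n d $$ (i, j) = (if i = j then complex_of_real (d (Suc i)) else 0)"
proof -
  let ?l = "map (\<lambda>i. complex_of_real (d i)) [1..<Suc n]"
  have len: "length ?l = n" by (simp only: length_map length_upt diff_Suc_1 One_nat_def)
  have "[1..<Suc n] ! i = Suc i" using assms(1) by (subst nth_upt) simp_all
  then have nth: "?l ! i = complex_of_real (d (Suc i))"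
    using assms(1) len by (metis length_map nth_map)
  show ?thesis
    unfolding real_diag_def using mk_diagonal_index[of i ?l j] assms len nth by presburger
qed

(* For nonincreasing values the two counts determine the sign pattern by position. *)
lemma sign_pattern:
  fixes l :: "nat \<Rightarrow> real"
  assumes mono: "\<forall>i\<in>{1..n}. \<forall>j\<in>{1..n}. i \<le> j \<longrightarrow> l j \<le> l i"
    and p: "p = card {i\<in>{1..n}. l i > 0}" and m: "m = card {i\<in>{1..n}. l i < 0}"
    and i: "i \<in> {1..n}"
  shows "l i > 0 \<longleftrightarrow> i \<le> p" and "l i < 0 \<longleftrightarrow> n - m < i"
proof -
  show "l i > 0 \<longleftrightarrow> i \<le> p"
  proof
    assume "l i > 0"
    with mono i have "{1..i} \<subseteq> {i\<in>{1..n}. l i > 0}" by fastforce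
    from card_mono[OF _ this] show "i \<le> p" by (simp add: p)
  next
    assume "i \<le> p"
    show "l i > 0"
    proof (rule ccontr)
      assume *: "\<not> l i > 0"
      have "{i\<in>{1..n}. l i > 0} \<subseteq> {1..i - 1}"
      proof
        fix j assume j: "j \<in> {i\<in>{1..n}. l i > 0}"
        have "\<not> i \<le> j" using mono i j * by fastforce
        with j show "j \<in> {1..i - 1}" by auto
      qed
      from card_mono[OF _ this] show False using \<open>i \<le> p\<close> i by (auto simp: p)
    qed
  qed
  show "l i < 0 \<longleftrightarrow> n - m < i"
  proof
    assume "l i < 0"
    with mono i have "{i..n} \<subseteq> {i\<in>{1..n}. l i < 0}" by fastforce
    from card_mono[OF _ this] show "n - m < i" using i by (auto simp: m)
  next
    assume a: "n - m < i"
    show "l i < 0"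
    proof (rule ccontr)
      assume *: "\<not> l i < 0"
      have "{i\<in>{1..n}. l i < 0} \<subseteq> {Suc i..n}"
      proof
        fix j assume j: "j \<in> {i\<in>{1..n}. l i < 0}"
        have "\<not> j \<le> i" using mono i j * by fastforce
        with j show "j \<in> {Suc i..n}" by auto
      qed
      from card_mono[OF _ this] show False using a i by (auto simp: m)
    qed
  qed
qed

end

theory Submission
  imports Defs
begin

text \<open>
  Everything is decided by the skew part \<open>S(A) = (A - A\<^sup>*) / (2 \<i>)\<close>, whose quadratic form is the
  imaginary part of that of \<open>A\<close>. If \<open>X = H + G B\<^sup>*\<close>, then \<open>S(X)\<close> has at most \<open>k\<close> positive and at most
  \<open>k\<close> negative eigenvalues, and conversely every such skew part occurs. So the best one can do is to
  keep the \<open>k\<close> largest positive and the \<open>k\<close> most negative eigenvalues of \<open>S(A)\<close>, paying for the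
  others.

  Membership of the candidate rests on \<open>real_diag_skew_factorization\<close>, transported by the unitary
  matrix in \<open>hermitian_plus_rank_if_inertia\<close>: positive and negative eigenvalues can share the same
  \<open>k\<close> columns of \<open>G\<close> and \<open>B\<close>.

  Optimality (\<open>distance_lower_bound\<close>) is usually derived from Weyl's inequalities. Here it is proved
  with test vectors. For an orthonormal family \<open>v\<^sub>j\<close>, Bessel's inequality for the rank-one matrices
  \<open>v\<^sub>j v\<^sub>j\<^sup>*\<close> bounds the sum of \<open>\<bar>v\<^sub>j\<^sup>* Z v\<^sub>j\<bar>\<^sup>2\<close> by the squared Frobenius norm of \<open>Z = A - X\<close>
  (\<open>sum_forms_le_frobenius\<close>). It remains to find, for each discarded eigenvalue \<open>\<lambda>\<^sub>j\<close>, a vector with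
  \<open>\<bar>v\<^sub>j\<^sup>* Z v\<^sub>j\<bar> \<ge> \<bar>\<lambda>\<^sub>j\<bar>\<close>. Suppose \<open>\<lambda>\<^sub>j > 0\<close>. Within the span of the first \<open>j\<close> eigenvectors the form
  of \<open>S(A)\<close> is at least \<open>\<lambda>\<^sub>j\<close> on unit vectors, and the \<open>k\<close> linear conditions
  \<open>B\<^sup>* v = - \<i> G\<^sup>* v\<close> make the form of \<open>S(X)\<close> nonpositive (\<open>im_form_hermitian_plus_rank\<close>). Counting
  equations and unknowns, one can pick orthonormal vectors satisfying these conditions, one in each of
  these spans for \<open>j > k\<close> (\<open>orthonormal_flag\<close>). Negative eigenvalues are treated from the other end,
  with \<open>\<i>\<close> in place of \<open>- \<i>\<close>. The two families are orthogonal to each other since they use disjoint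
  sets of eigenvectors.
\<close>

section \<open>Adjoints and the Hermitian inner product\<close>

lemma mat_adjoint_dim [simp]:
  "dim_row (mat_adjoint A) = dim_col A" "dim_col (mat_adjoint A) = dim_row A"
  by (simp_all add: mat_adjoint_def)

lemma mat_adjoint_carrier [simp, intro]:
  "A \<in> carrier_mat n m \<Longrightarrow> mat_adjoint A \<in> carrier_mat m n"
  by (rule carrier_matI) simp_all

lemma mat_adjoint_index [simp]:
  fixes A :: "complex mat"
  assumes "i < dim_col A" "j < dim_row A"
  shows "mat_adjoint A $$ (i, j) = cnj (A $$ (j, i))"
  using assms by (simp add: mat_adjoint_def mat_of_rows_def)

lemma mult_mat_index_sum:
  assumes "A \<in> carrier_mat n m" "B \<in> carrier_mat m l" "a < n" "b < l"
  shows "(A * B) $$ (a, b) = (\<Sum>j<m. A $$ (a, j) * B $$ (j, b))"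
  using assms by (simp add: scalar_prod_def atLeast0LessThan)

lemma mat_adjoint_mult:
  fixes A B :: "complex mat"
  assumes A: "A \<in> carrier_mat n m" and B: "B \<in> carrier_mat m l"
  shows "mat_adjoint (A * B) = mat_adjoint B * mat_adjoint A"
proof (rule eq_matI)
  fix i j
  assume "i < dim_row (mat_adjoint B * mat_adjoint A)"
    and "j < dim_col (mat_adjoint B * mat_adjoint A)"
  with A B have "i < l" "j < n" by auto
  with A B show "mat_adjoint (A * B) $$ (i, j) = (mat_adjoint B * mat_adjoint A) $$ (i, j)"
    by (auto simp: scalar_prod_def mult.commute intro!: sum.cong)
qed (use A B in auto)

lemma mat_adjoint_adjoint [simp]:
  fixes A :: "complex mat"
  shows "mat_adjoint (mat_adjoint A) = A"
  by (rule eq_matI) auto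

lemma minus_adjoint_index:
  fixes P :: "complex mat"
  assumes "P \<in> carrier_mat n n" "i < n" "j < n"
  shows "(P - mat_adjoint P) $$ (i, j) = P $$ (i, j) - cnj (P $$ (j, i))"
  using assms by simp

lemma congruence_minus_adjoint:
  fixes U Q :: "complex mat"
  assumes U: "U \<in> carrier_mat n n" and Q: "Q \<in> carrier_mat n n"
  shows "U * Q * mat_adjoint U - mat_adjoint (U * Q * mat_adjoint U)
    = U * (Q - mat_adjoint Q) * mat_adjoint U"
proof -
  have U': "mat_adjoint U \<in> carrier_mat n n" and Q': "mat_adjoint Q \<in> carrier_mat n n"
    using U Q by (auto intro: mat_adjoint_carrier)
  have UQ: "U * Q \<in> carrier_mat n n" and UQ': "U * mat_adjoint Q \<in> carrier_mat n n"
    using U Q Q' by (auto intro: mult_carrier_mat)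
  have "mat_adjoint (U * Q * mat_adjoint U) = U * (mat_adjoint Q * mat_adjoint U)"
    by (simp only: mat_adjoint_mult[OF UQ U'] mat_adjoint_mult[OF U Q] mat_adjoint_adjoint)
  also have "\<dots> = U * mat_adjoint Q * mat_adjoint U"
    by (rule assoc_mult_mat[OF U Q' U', symmetric])
  finally show ?thesis
    by (simp only: mult_minus_distrib_mat[OF U Q Q'] minus_mult_distrib_mat[OF UQ UQ' U'])
qed

lemma smult_mult_mat_vec:
  fixes A :: "complex mat"
  assumes "A \<in> carrier_mat n m" "v \<in> carrier_vec m"
  shows "(c \<cdot>\<^sub>m A) *\<^sub>v v = c \<cdot>\<^sub>v (A *\<^sub>v v)"
  using assms by (intro eq_vecI) auto

lemma cscalar_prod_eq_sum:
  fixes v w :: "complex vec"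
  assumes "w \<in> carrier_vec n"
  shows "v \<bullet>c w = (\<Sum>i<n. v $ i * cnj (w $ i))"
  using assms by (simp add: scalar_prod_def atLeast0LessThan)

lemma cscalar_prod_commute:
  fixes v w :: "complex vec"
  assumes "v \<in> carrier_vec n" "w \<in> carrier_vec n"
  shows "w \<bullet>c v = cnj (v \<bullet>c w)"
  using assms by (simp add: cscalar_prod_eq_sum[of _ n] mult.commute)

lemma cscalar_prod_self:
  fixes v :: "complex vec"
  assumes "v \<in> carrier_vec n"
  shows "v \<bullet>c v = complex_of_real (\<Sum>i<n. (cmod (v $ i))\<^sup>2)"
  by (simp only: cscalar_prod_eq_sum[OF assms] of_real_sum complex_norm_square)

lemma cscalar_prod_smult:
  fixes v w :: "complex vec"
  assumes "v \<in> carrier_vec n" "w \<in> carrier_vec n"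
  shows "(r \<cdot>\<^sub>v v) \<bullet>c w = r * (v \<bullet>c w)"
  using assms by simp

lemma cscalar_prod_adjoint:
  fixes A :: "complex mat"
  assumes A: "A \<in> carrier_mat n m" and v: "v \<in> carrier_vec m" and w: "w \<in> carrier_vec n"
  shows "(A *\<^sub>v v) \<bullet>c w = v \<bullet>c (mat_adjoint A *\<^sub>v w)"
proof -
  have "(A *\<^sub>v v) \<bullet>c w = (\<Sum>i<n. \<Sum>j<m. A $$ (i, j) * v $ j * cnj (w $ i))"
    using assms by (simp add: cscalar_prod_eq_sum[of _ n] scalar_prod_def atLeast0LessThan
        sum_distrib_right)
  also have "\<dots> = (\<Sum>j<m. \<Sum>i<n. A $$ (i, j) * v $ j * cnj (w $ i))"
    by (rule sum.swap)
  also have "\<dots> = v \<bullet>c (mat_adjoint A *\<^sub>v w)"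
    using assms by (simp add: cscalar_prod_eq_sum[of _ m] scalar_prod_def atLeast0LessThan
        sum_distrib_left mult_ac)
  finally show ?thesis .
qed

lemma unitary_adjoint_mult:
  assumes "U \<in> carrier_mat n n" "unitary_mat U"
  shows "mat_adjoint U * U = 1\<^sub>m n"
  using assms by (auto simp: unitary_mat_def inverts_mat_def)

lemma unitary_cscalar_prod:
  assumes U: "U \<in> carrier_mat n n" "unitary_mat U"
    and v: "v \<in> carrier_vec n" and w: "w \<in> carrier_vec n"
  shows "(U *\<^sub>v v) \<bullet>c (U *\<^sub>v w) = v \<bullet>c w"
proof -
  have "(U *\<^sub>v v) \<bullet>c (U *\<^sub>v w) = v \<bullet>c (mat_adjoint U *\<^sub>v (U *\<^sub>v w))"
    using U v w by (intro cscalar_prod_adjoint) auto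
  also have "mat_adjoint U *\<^sub>v (U *\<^sub>v w) = w"
    using assoc_mult_mat_vec[of "mat_adjoint U" n n U n w] U w
    by (simp add: unitary_adjoint_mult)
  finally show ?thesis .
qed

section \<open>Orthonormal families and the Frobenius norm\<close>

definition orthonormal_on :: "'j set \<Rightarrow> nat \<Rightarrow> ('j \<Rightarrow> complex vec) \<Rightarrow> bool" where
  "orthonormal_on J n v \<longleftrightarrow> (\<forall>j\<in>J. v j \<in> carrier_vec n) \<and>
     (\<forall>j\<in>J. \<forall>l\<in>J. v j \<bullet>c v l = (if j = l then 1 else 0))"

text \<open>
  Parseval for finite orthonormal systems of functions on an index set \<open>I\<close>. Arbitrary index sets
  allow matrices to be treated as functions on pairs of positions.
\<close>

lemma orthonormal_sum_norm:
  fixes g :: "'j \<Rightarrow> 'i \<Rightarrow> complex"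
  assumes J: "finite J"
    and g: "\<And>j l. j \<in> J \<Longrightarrow> l \<in> J \<Longrightarrow> (\<Sum>i\<in>I. g j i * cnj (g l i)) = (if j = l then 1 else 0)"
  shows "(\<Sum>i\<in>I. (cmod (\<Sum>j\<in>J. t j * g j i))\<^sup>2) = (\<Sum>j\<in>J. (cmod (t j))\<^sup>2)"
proof -
  have "complex_of_real (\<Sum>i\<in>I. (cmod (\<Sum>j\<in>J. t j * g j i))\<^sup>2)
      = (\<Sum>i\<in>I. \<Sum>j\<in>J. \<Sum>l\<in>J. t j * g j i * cnj (t l * g l i))"
    by (simp add: complex_norm_square sum_product del: of_real_power)
  also have "\<dots> = (\<Sum>j\<in>J. \<Sum>i\<in>I. \<Sum>l\<in>J. t j * g j i * cnj (t l * g l i))"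
    by (rule sum.swap)
  also have "\<dots> = (\<Sum>j\<in>J. \<Sum>l\<in>J. \<Sum>i\<in>I. t j * g j i * cnj (t l * g l i))"
    by (intro sum.cong refl) (rule sum.swap)
  also have "\<dots> = (\<Sum>j\<in>J. \<Sum>l\<in>J. t j * cnj (t l) * (\<Sum>i\<in>I. g j i * cnj (g l i)))"
    by (simp add: sum_distrib_left mult_ac)
  also have "\<dots> = (\<Sum>j\<in>J. \<Sum>l\<in>J. if j = l then t j * cnj (t l) else 0)"
    by (intro sum.cong refl) (simp add: g)
  also have "\<dots> = complex_of_real (\<Sum>j\<in>J. (cmod (t j))\<^sup>2)"
    using J by (simp add: complex_norm_square del: of_real_power)
  finally show ?thesis by (simp only: of_real_eq_iff)
qed

lemma bessel_inequality:
  fixes g :: "'j \<Rightarrow> 'i \<Rightarrow> complex"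
  assumes J: "finite J"
    and g: "\<And>j l. j \<in> J \<Longrightarrow> l \<in> J \<Longrightarrow> (\<Sum>i\<in>I. g j i * cnj (g l i)) = (if j = l then 1 else 0)"
  shows "(\<Sum>j\<in>J. (cmod (\<Sum>i\<in>I. f i * cnj (g j i)))\<^sup>2) \<le> (\<Sum>i\<in>I. (cmod (f i))\<^sup>2)"
proof -
  define t where "t j = (\<Sum>i\<in>I. f i * cnj (g j i))" for j
  define s where "s i = (\<Sum>j\<in>J. t j * g j i)" for i
  have ns: "(\<Sum>i\<in>I. (cmod (s i))\<^sup>2) = (\<Sum>j\<in>J. (cmod (t j))\<^sup>2)"
    unfolding s_def by (rule orthonormal_sum_norm[OF J g])
  have "(\<Sum>i\<in>I. f i * cnj (s i)) = (\<Sum>i\<in>I. \<Sum>j\<in>J. cnj (t j) * (f i * cnj (g j i)))"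
    by (simp add: s_def sum_distrib_left mult_ac)
  also have "\<dots> = (\<Sum>j\<in>J. \<Sum>i\<in>I. cnj (t j) * (f i * cnj (g j i)))"
    by (rule sum.swap)
  also have "\<dots> = (\<Sum>j\<in>J. cnj (t j) * t j)"
    by (simp add: t_def sum_distrib_left)
  also have "\<dots> = complex_of_real (\<Sum>j\<in>J. (cmod (t j))\<^sup>2)"
    by (simp add: complex_norm_square mult.commute del: of_real_power)
  finally have cross: "(\<Sum>i\<in>I. Re (f i * cnj (s i))) = (\<Sum>j\<in>J. (cmod (t j))\<^sup>2)"
    by (metis Re_complex_of_real Re_sum)
  \<comment> \<open>\<open>s\<close> is the orthogonal projection of \<open>f\<close>; the inequality is nonnegativity of the
    squared distance from \<open>f\<close> to it.\<close>
  have "0 \<le> (\<Sum>i\<in>I. (cmod (f i - s i))\<^sup>2)" by (simp add: sum_nonneg)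
  also have "\<dots> = (\<Sum>i\<in>I. (cmod (f i))\<^sup>2 + (cmod (s i))\<^sup>2 - 2 * Re (f i * cnj (s i)))"
    by (intro sum.cong refl) (simp only: cmod_power2, simp add: power2_eq_square algebra_simps)
  also have "\<dots> = (\<Sum>i\<in>I. (cmod (f i))\<^sup>2) - (\<Sum>j\<in>J. (cmod (t j))\<^sup>2)"
    by (simp only: sum.distrib sum_subtractf ns sum_distrib_left[symmetric] cross)
  finally show ?thesis by (simp add: t_def)
qed

text \<open>
  The rank-one matrices \<open>v v\<^sup>*\<close> of an orthonormal family are orthonormal for the Frobenius inner
  product, since \<open>\<langle>v v\<^sup>*, u u\<^sup>*\<rangle> = \<bar>\<langle>v, u\<rangle>\<bar>\<^sup>2\<close>. Parseval and Bessel for these matrices give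
  the norm identity and the norm bound below.
\<close>

lemma rank_one_orthonormal:
  assumes v: "orthonormal_on J n v" and "j \<in> J" "l \<in> J"
  shows "(\<Sum>(a, b)\<in>{..<n} \<times> {..<n}. (v j $ a * cnj (v j $ b)) * cnj (v l $ a * cnj (v l $ b)))
    = (if j = l then 1 else 0)"
proof -
  have "(\<Sum>(a, b)\<in>{..<n} \<times> {..<n}. (v j $ a * cnj (v j $ b)) * cnj (v l $ a * cnj (v l $ b)))
      = (v j \<bullet>c v l) * cnj (v j \<bullet>c v l)"
    using assms by (simp add: cscalar_prod_eq_sum[of _ n] orthonormal_on_def sum_product
        sum.cartesian_product mult_ac)
  then show ?thesis using assms by (simp add: orthonormal_on_def)
qed

lemma frobenius_norm_power2:
  assumes "M \<in> carrier_mat n n"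
  shows "(frobenius_norm M)\<^sup>2 = (\<Sum>(a, b)\<in>{..<n} \<times> {..<n}. (cmod (M $$ (a, b)))\<^sup>2)"
  using assms by (simp add: frobenius_norm_def sum_nonneg sum.cartesian_product)

lemma frobenius_norm_smult:
  "frobenius_norm (c \<cdot>\<^sub>m M) = cmod c * frobenius_norm M"
  by (simp add: frobenius_norm_def norm_mult power_mult_distrib real_sqrt_mult flip: sum_distrib_left)

text \<open>
  The value \<open>v\<^sup>* Z v\<close> is the Frobenius inner product of \<open>Z\<close> with \<open>v v\<^sup>*\<close>, so this is Bessel's
  inequality.
\<close>

lemma sum_forms_le_frobenius:
  assumes Z: "Z \<in> carrier_mat n n" and J: "finite J" and v: "orthonormal_on J n v"
  shows "(\<Sum>j\<in>J. (cmod ((Z *\<^sub>v v j) \<bullet>c v j))\<^sup>2) \<le> (frobenius_norm Z)\<^sup>2"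
proof -
  define g where "g j = (\<lambda>(a, b). v j $ a * cnj (v j $ b))" for j
  have "(Z *\<^sub>v v j) \<bullet>c v j
      = (\<Sum>p\<in>{..<n} \<times> {..<n}. Z $$ p * cnj (g j p))" if "j \<in> J" for j
  proof -
    have vj: "v j \<in> carrier_vec n" using that v by (simp add: orthonormal_on_def)
    have "(Z *\<^sub>v v j) \<bullet>c v j = (\<Sum>a<n. (\<Sum>b<n. Z $$ (a, b) * v j $ b) * cnj (v j $ a))"
      using Z vj by (simp add: cscalar_prod_eq_sum[of _ n] scalar_prod_def atLeast0LessThan)
    also have "\<dots> = (\<Sum>a<n. \<Sum>b<n. Z $$ (a, b) * cnj (g j (a, b)))"
      by (simp add: sum_distrib_left g_def mult_ac)
    finally show ?thesis by (simp add: sum.cartesian_product)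
  qed
  then have "(\<Sum>j\<in>J. (cmod ((Z *\<^sub>v v j) \<bullet>c v j))\<^sup>2)
      = (\<Sum>j\<in>J. (cmod (\<Sum>p\<in>{..<n} \<times> {..<n}. Z $$ p * cnj (g j p)))\<^sup>2)"
    by simp
  also have "\<dots> \<le> (\<Sum>p\<in>{..<n} \<times> {..<n}. (cmod (Z $$ p))\<^sup>2)"
    using rank_one_orthonormal[OF v] by (intro bessel_inequality J) (auto simp: g_def split_def)
  finally show ?thesis using Z by (simp add: frobenius_norm_power2 split_def)
qed

lemma congruence_diag_index:
  assumes U: "U \<in> carrier_mat n n" and ab: "a < n" "b < n"
  shows "(U * real_diag n d * mat_adjoint U) $$ (a, b)
    = (\<Sum>j<n. of_real (d (Suc j)) * (U $$ (a, j) * cnj (U $$ (b, j))))"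
proof -
  have "(U * real_diag n d) $$ (a, j) = U $$ (a, j) * of_real (d (Suc j))" if "j < n" for j
    using that U ab
    by (simp add: mult_mat_index_sum[OF U real_diag_carrier] real_diag_index if_distrib cong: if_cong
        del: index_mult_mat)
  then show ?thesis
    using ab U
    by (simp add: mult_mat_index_sum[OF mult_carrier_mat[OF U real_diag_carrier] mat_adjoint_carrier[OF U]]
        mult_ac del: index_mult_mat)
qed

text \<open>
  The matrix is the combination of the rank-one matrices of the columns of \<open>U\<close> with coefficients
  \<open>d\<close>, so this is Parseval's identity.
\<close>

lemma frobenius_norm_congruence_diag:
  assumes U: "U \<in> carrier_mat n n" "unitary_mat U"
  shows "(frobenius_norm (U * real_diag n d * mat_adjoint U))\<^sup>2 = (\<Sum>j<n. (d (Suc j))\<^sup>2)"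
proof -
  define g where "g j = (\<lambda>(a, b). col U j $ a * cnj (col U j $ b))" for j
  have "col U j \<bullet>c col U l = (if j = l then 1 else 0)" if "j < n" "l < n" for j l
  proof -
    have "(mat_adjoint U * U) $$ (l, j) = (\<Sum>a<n. U $$ (a, j) * cnj (U $$ (a, l)))"
      using U that by (simp add: scalar_prod_def atLeast0LessThan mult.commute)
    also have "\<dots> = col U j \<bullet>c col U l"
      using U that by (simp add: cscalar_prod_eq_sum[of _ n])
    finally show ?thesis using unitary_adjoint_mult[OF U] that by (auto split: if_splits)
  qed
  then have on: "orthonormal_on {..<n} n (col U)"
    using U by (auto simp: orthonormal_on_def)
  have "(U * real_diag n d * mat_adjoint U) $$ p = (\<Sum>j<n. of_real (d (Suc j)) * g j p)"
    if "p \<in> {..<n} \<times> {..<n}" for p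
    using that U by (auto simp: g_def congruence_diag_index[OF U(1)] simp del: index_mult_mat)
  moreover have "U * real_diag n d * mat_adjoint U \<in> carrier_mat n n"
    using U by (meson mat_adjoint_carrier mult_carrier_mat real_diag_carrier)
  ultimately have "(frobenius_norm (U * real_diag n d * mat_adjoint U))\<^sup>2
      = (\<Sum>p\<in>{..<n} \<times> {..<n}. (cmod (\<Sum>j<n. of_real (d (Suc j)) * g j p))\<^sup>2)"
    by (simp add: frobenius_norm_power2 split_def del: index_mult_mat)
  also have "\<dots> = (\<Sum>j<n. (cmod (complex_of_real (d (Suc j))))\<^sup>2)"
    using rank_one_orthonormal[OF on] by (intro orthonormal_sum_norm) (auto simp: g_def split_def)
  finally show ?thesis by simp
qed

section \<open>Orthonormal flags in the kernel of a linear system\<close>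

lemma underdetermined_solution:
  fixes a :: "nat \<Rightarrow> nat \<Rightarrow> complex"
  assumes m: "m < n"
  obtains x where "x \<in> carrier_vec n" "x \<noteq> 0\<^sub>v n" "\<And>i. m < i \<Longrightarrow> i < n \<Longrightarrow> x $ i = 0"
    "\<And>l. l < m \<Longrightarrow> (\<Sum>i<n. a l i * x $ i) = 0"
proof -
  \<comment> \<open>Square up the system: the equations are rows \<open>0..<m\<close>, unit rows beyond \<open>m\<close> force the
    trailing unknowns to vanish, and the zero row left over at \<open>m\<close> makes the matrix singular.\<close>
  define c where "c l = (if l < m then vec n (a l) else unit_vec n l)" for l
  define M where "M = mat\<^sub>r n n (\<lambda>l. if l = m then 0\<^sub>v n else c l)"
  have M: "M \<in> carrier_mat n n" by (simp add: M_def)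
  have "det M = 0" unfolding M_def by (rule det_row_0[OF m]) (auto simp: c_def)
  with det_0_iff_vec_prod_zero[OF M] obtain x where
    x: "x \<in> carrier_vec n" "x \<noteq> 0\<^sub>v n" "M *\<^sub>v x = 0\<^sub>v n" by blast
  have c: "c l \<bullet> x = 0" if "l < n" "l \<noteq> m" for l
  proof -
    have "row M l = c l" using that by (auto simp: M_def c_def)
    moreover have "(M *\<^sub>v x) $ l = 0" using x(3) that by simp
    ultimately show ?thesis using that M by simp
  qed
  show thesis
  proof (rule that[OF x(1,2)])
    fix i assume "m < i" "i < n"
    with c[of i] x(1) show "x $ i = 0" by (simp add: c_def)
  next
    fix l assume "l < m"
    with c[of l] m x(1) show "(\<Sum>i<n. a l i * x $ i) = 0"
      by (simp add: c_def scalar_prod_def atLeast0LessThan)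
  qed
qed

lemma normalize_vec:
  fixes x :: "complex vec"
  assumes x: "x \<in> carrier_vec n" "x \<noteq> 0\<^sub>v n"
  obtains r :: complex where "(r \<cdot>\<^sub>v x) \<bullet>c (r \<cdot>\<^sub>v x) = 1"
proof -
  define s where "s = (\<Sum>i<n. (cmod (x $ i))\<^sup>2)"
  have xs: "x \<bullet>c x = complex_of_real s"
    unfolding s_def by (rule cscalar_prod_self[OF x(1)])
  have "s \<noteq> 0" using xs x by (metis conjugate_square_eq_0_vec of_real_0)
  moreover have "s \<ge> 0" by (simp add: s_def sum_nonneg)
  ultimately have "complex_of_real (1 / sqrt s) * complex_of_real (1 / sqrt s) * complex_of_real s = 1"
    unfolding of_real_mult[symmetric] by simp
  then have "(complex_of_real (1 / sqrt s) \<cdot>\<^sub>v x) \<bullet>c (complex_of_real (1 / sqrt s) \<cdot>\<^sub>v x) = 1"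
    using x(1) by (simp add: conjugate_smult_vec xs mult.assoc)
  then show thesis by (rule that)
qed

text \<open>
  Adapting an orthonormal family to the standard flag replaces the min-max characterization of
  eigenvalues. The kernel of \<open>k\<close> equations meets the span of the first \<open>j + 1\<close> coordinate vectors
  in dimension at least \<open>j + 1 - k\<close>, which leaves room for one new direction at every \<open>j \<ge> k\<close>.
  The upper end \<open>m\<close> is there for the induction.
\<close>

lemma orthonormal_flag_upto:
  fixes C :: "complex mat"
  assumes C: "C \<in> carrier_mat k n" and "m \<le> n"
  shows "\<exists>w. orthonormal_on {k..<m} n w \<and>
    (\<forall>j\<in>{k..<m}. C *\<^sub>v w j = 0\<^sub>v k \<and> (\<forall>i<n. j < i \<longrightarrow> w j $ i = 0))"
  using \<open>m \<le> n\<close>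
proof (induction m)
  case 0
  show ?case by (simp add: orthonormal_on_def)
next
  case (Suc m)
  then obtain w where w: "orthonormal_on {k..<m} n w"
    "\<forall>j\<in>{k..<m}. C *\<^sub>v w j = 0\<^sub>v k \<and> (\<forall>i<n. j < i \<longrightarrow> w j $ i = 0)" by auto
  show ?case
  proof (cases "k \<le> m")
    case False
    then show ?thesis by (simp add: orthonormal_on_def)
  next
    case True
    from Suc.prems have "m < n" by simp
    \<comment> \<open>The next vector has \<open>m + 1\<close> free coordinates and must satisfy the \<open>k\<close> equations of \<open>C\<close>
      and be orthogonal to the \<open>m - k\<close> vectors already found: \<open>m\<close> equations, listed by \<open>a\<close>.\<close>
    define a where "a l i = (if l < k then C $$ (l, i) else cnj (w l $ i))" for l i
    obtain x where x: "x \<in> carrier_vec n" "x \<noteq> 0\<^sub>v n" "\<And>i. m < i \<Longrightarrow> i < n \<Longrightarrow> x $ i = 0"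
      "\<And>l. l < m \<Longrightarrow> (\<Sum>i<n. a l i * x $ i) = 0"
      using underdetermined_solution[OF \<open>m < n\<close>, of a] by metis
    obtain r where r: "(r \<cdot>\<^sub>v x) \<bullet>c (r \<cdot>\<^sub>v x) = 1" using normalize_vec[OF x(1,2)] .
    define u where "u = r \<cdot>\<^sub>v x"
    have u: "u \<in> carrier_vec n" using x(1) by (simp add: u_def)
    have au: "(\<Sum>i<n. a l i * u $ i) = 0" if "l < m" for l
    proof -
      have "(\<Sum>i<n. a l i * u $ i) = r * (\<Sum>i<n. a l i * x $ i)"
        using x(1) by (simp add: u_def sum_distrib_left mult_ac)
      then show ?thesis using x(4)[OF that] by simp
    qed
    have Cu: "C *\<^sub>v u = 0\<^sub>v k"
    proof (rule eq_vecI)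
      fix l assume l: "l < dim_vec (0\<^sub>v k :: complex vec)"
      then have "(C *\<^sub>v u) $ l = (\<Sum>i<n. C $$ (l, i) * u $ i)"
        using C u by (simp add: scalar_prod_def atLeast0LessThan)
      then show "(C *\<^sub>v u) $ l = 0\<^sub>v k $ l" using au[of l] True l by (simp add: a_def)
    qed (use C in auto)
    have ortho: "u \<bullet>c w l = 0" "w l \<bullet>c u = 0" if "l \<in> {k..<m}" for l
    proof -
      have wl: "w l \<in> carrier_vec n" using w(1) that by (simp add: orthonormal_on_def)
      show 0: "u \<bullet>c w l = 0"
        using au[of l] that wl by (simp add: cscalar_prod_eq_sum[of _ n] a_def mult.commute)
      show "w l \<bullet>c u = 0" using cscalar_prod_commute[OF u wl] 0 by simp
    qed
    have supp: "u $ i = 0" if "m < i" "i < n" for i using x(1) x(3)[OF that] that by (simp add: u_def)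
    have uu: "u \<bullet>c u = 1" using r by (simp add: u_def)
    have "orthonormal_on {k..<Suc m} n (w(m := u))"
      using w(1) u ortho uu True by (auto simp: orthonormal_on_def less_Suc_eq)
    moreover have "C *\<^sub>v (w(m := u)) j = 0\<^sub>v k \<and> (\<forall>i<n. j < i \<longrightarrow> (w(m := u)) j $ i = 0)"
      if "j \<in> {k..<Suc m}" for j
      using that w(2) Cu supp by (auto simp: less_Suc_eq)
    ultimately show ?thesis by blast
  qed
qed

lemma orthonormal_flag:
  fixes C :: "complex mat"
  assumes "C \<in> carrier_mat k n"
  obtains w where "orthonormal_on {k..<n} n w" "\<And>j. j \<in> {k..<n} \<Longrightarrow> C *\<^sub>v w j = 0\<^sub>v k"
    "\<And>i j. j \<in> {k..<n} \<Longrightarrow> j < i \<Longrightarrow> i < n \<Longrightarrow> w j $ i = 0"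
  using orthonormal_flag_upto[OF assms order_refl] by metis

text \<open>
  The same with respect to the flag of the spans of the last coordinate vectors, by reversing the
  order of the coordinates.
\<close>

lemma orthonormal_opposite_flag:
  fixes C :: "complex mat"
  assumes C: "C \<in> carrier_mat k n"
  obtains w where "orthonormal_on {..<n - k} n w" "\<And>j. j < n - k \<Longrightarrow> C *\<^sub>v w j = 0\<^sub>v k"
    "\<And>i j. j < n - k \<Longrightarrow> i < j \<Longrightarrow> w j $ i = 0"
proof -
  define rev where "rev v = vec n (\<lambda>i. v $ (n - Suc i))" for v :: "complex vec"
  define C' where "C' = mat k n (\<lambda>(l, i). C $$ (l, n - Suc i))"
  obtain w where w: "orthonormal_on {k..<n} n w" "\<And>j. j \<in> {k..<n} \<Longrightarrow> C' *\<^sub>v w j = 0\<^sub>v k"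
    "\<And>i j. j \<in> {k..<n} \<Longrightarrow> j < i \<Longrightarrow> i < n \<Longrightarrow> w j $ i = 0"
    by (rule orthonormal_flag[of C' k n]) (auto simp: C'_def)
  have dot: "rev u \<bullet>c rev v = u \<bullet>c v" if "u \<in> carrier_vec n" "v \<in> carrier_vec n" for u v
  proof -
    have "rev u \<bullet>c rev v = (\<Sum>i<n. u $ (n - Suc i) * cnj (v $ (n - Suc i)))"
      by (subst cscalar_prod_eq_sum[of _ n]) (simp_all add: rev_def)
    also have "\<dots> = u \<bullet>c v"
      using that sum.nat_diff_reindex[of "\<lambda>i. u $ i * cnj (v $ i)" n]
      by (simp add: cscalar_prod_eq_sum[of _ n])
    finally show ?thesis .
  qed
  have C_rev: "C *\<^sub>v rev v = C' *\<^sub>v v" if v: "v \<in> carrier_vec n" for v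
  proof (rule eq_vecI)
    fix l assume "l < dim_vec (C' *\<^sub>v v)"
    then have l: "l < k" by (simp add: C'_def)
    have "(C *\<^sub>v rev v) $ l = (\<Sum>i<n. C $$ (l, i) * v $ (n - Suc i))"
      using C l by (simp add: rev_def scalar_prod_def atLeast0LessThan)
    also have "\<dots> = (\<Sum>i<n. C $$ (l, n - Suc i) * v $ i)"
      by (subst sum.nat_diff_reindex[symmetric]) (simp add: Suc_diff_Suc)
    also have "\<dots> = (C' *\<^sub>v v) $ l"
      using l v by (simp add: C'_def scalar_prod_def atLeast0LessThan)
    finally show "(C *\<^sub>v rev v) $ l = (C' *\<^sub>v v) $ l" .
  qed (use C in \<open>simp add: C'_def\<close>)
  define y where "y j = rev (w (n - Suc j))" for j
  have range: "n - Suc j \<in> {k..<n}" if "j < n - k" for j using that by auto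
  have wn: "w (n - Suc j) \<in> carrier_vec n" if "j < n - k" for j
    using w(1) range[OF that] unfolding orthonormal_on_def by blast
  show thesis
  proof (rule that[of y])
    show "orthonormal_on {..<n - k} n y"
      unfolding orthonormal_on_def
    proof (intro conjI ballI)
      fix j l assume jl: "j \<in> {..<n - k}" "l \<in> {..<n - k}"
      then have "y j \<bullet>c y l = w (n - Suc j) \<bullet>c w (n - Suc l)"
        unfolding y_def by (intro dot wn) auto
      also have "\<dots> = (if n - Suc j = n - Suc l then 1 else 0)"
        using w(1) range jl unfolding orthonormal_on_def by blast
      also have "n - Suc j = n - Suc l \<longleftrightarrow> j = l" using jl by auto
      finally show "y j \<bullet>c y l = (if j = l then 1 else 0)" .
    qed (simp add: y_def rev_def)
    show "C *\<^sub>v y j = 0\<^sub>v k" if "j < n - k" for j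
      using C_rev[OF wn[OF that]] w(2)[OF range[OF that]] by (simp add: y_def)
    show "y j $ i = 0" if "j < n - k" "i < j" for i j
      using w(3)[OF range[OF that(1)], of "n - Suc i"] that by (simp add: y_def rev_def)
  qed
qed

section \<open>Imaginary parts of quadratic forms\<close>

lemma minus_adjoint_eq_skew_part:
  fixes A :: "complex mat"
  assumes "A \<in> carrier_mat n n"
  shows "A - mat_adjoint A = (2 * \<i>) \<cdot>\<^sub>m skew_part A"
  using assms by (intro eq_matI) (auto simp: skew_part_def)

lemma skew_part_form:
  assumes A: "A \<in> carrier_mat n n" and v: "v \<in> carrier_vec n"
  shows "(skew_part A *\<^sub>v v) \<bullet>c v = complex_of_real (Im ((A *\<^sub>v v) \<bullet>c v))"
proof -
  have A': "mat_adjoint A \<in> carrier_mat n n" using A by (rule mat_adjoint_carrier)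
  have Av: "A *\<^sub>v v \<in> carrier_vec n" and A'v: "mat_adjoint A *\<^sub>v v \<in> carrier_vec n"
    using mult_mat_vec_carrier[OF A v] mult_mat_vec_carrier[OF A' v] by simp_all
  have "skew_part A *\<^sub>v v = (1 / (2 * \<i>)) \<cdot>\<^sub>v (A *\<^sub>v v - mat_adjoint A *\<^sub>v v)"
    unfolding skew_part_def smult_mult_mat_vec[OF minus_carrier_mat[OF A'] v]
      minus_mult_distrib_mat_vec[OF A A' v] by (rule refl)
  then have "(skew_part A *\<^sub>v v) \<bullet>c v
      = (1 / (2 * \<i>)) * ((A *\<^sub>v v) \<bullet>c v - (mat_adjoint A *\<^sub>v v) \<bullet>c v)"
    using cscalar_prod_smult[OF minus_carrier_vec[OF Av A'v] v]
      minus_scalar_prod_distrib[OF Av A'v, of "conjugate v"] v by simp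
  also have "(mat_adjoint A *\<^sub>v v) \<bullet>c v = cnj ((A *\<^sub>v v) \<bullet>c v)"
    using cscalar_prod_adjoint[OF A' v v] cscalar_prod_commute[OF Av v] by simp
  also have "(1 / (2 * \<i>)) * ((A *\<^sub>v v) \<bullet>c v - cnj ((A *\<^sub>v v) \<bullet>c v))
      = complex_of_real (Im ((A *\<^sub>v v) \<bullet>c v))"
    by (simp add: complex_eq_iff complex_diff_cnj)
  finally show ?thesis .
qed

lemma real_diag_form:
  assumes w: "w \<in> carrier_vec n"
  shows "(real_diag n d *\<^sub>v w) \<bullet>c w = complex_of_real (\<Sum>i<n. d (Suc i) * (cmod (w $ i))\<^sup>2)"
proof -
  have "(real_diag n d *\<^sub>v w) $ i = of_real (d (Suc i)) * w $ i" if i: "i < n" for i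
  proof -
    have "(real_diag n d *\<^sub>v w) $ i = (\<Sum>j<n. if i = j then of_real (d (Suc i)) * w $ j else 0)"
      using i w carrier_matD[OF real_diag_carrier[of n d]]
      by (simp add: scalar_prod_def atLeast0LessThan real_diag_index if_distrib[of "\<lambda>x. x * _"] cong: if_cong)
    then show ?thesis using i by simp
  qed
  then show ?thesis
    using w by (simp only: cscalar_prod_eq_sum[OF w] of_real_sum of_real_mult complex_norm_square)
       (simp add: mult.assoc)
qed

lemma im_form_eigenbasis:
  assumes A: "A \<in> carrier_mat n n" and U: "U \<in> carrier_mat n n" "unitary_mat U"
    and eig: "skew_part A = U * real_diag n d * mat_adjoint U" and w: "w \<in> carrier_vec n"
  shows "Im ((A *\<^sub>v (U *\<^sub>v w)) \<bullet>c (U *\<^sub>v w)) = (\<Sum>i<n. d (Suc i) * (cmod (w $ i))\<^sup>2)"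
proof -
  let ?D = "real_diag n d"
  have U': "mat_adjoint U \<in> carrier_mat n n" using U(1) by (rule mat_adjoint_carrier)
  have Uw: "U *\<^sub>v w \<in> carrier_vec n" and Dw: "?D *\<^sub>v w \<in> carrier_vec n"
    using U w mult_mat_vec_carrier[OF real_diag_carrier w] by simp_all
  have U'Uw: "mat_adjoint U *\<^sub>v (U *\<^sub>v w) = w"
    using assoc_mult_mat_vec[OF U' U(1) w] w by (simp add: unitary_adjoint_mult[OF U])
  have UD: "U * ?D \<in> carrier_mat n n" using U(1) real_diag_carrier by (rule mult_carrier_mat)
  have "skew_part A *\<^sub>v (U *\<^sub>v w) = (U * ?D) *\<^sub>v w"
    unfolding eig using assoc_mult_mat_vec[OF UD U' Uw] U'Uw by simp
  also have "\<dots> = U *\<^sub>v (?D *\<^sub>v w)" by (rule assoc_mult_mat_vec[OF U(1) real_diag_carrier w])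
  finally have "(skew_part A *\<^sub>v (U *\<^sub>v w)) \<bullet>c (U *\<^sub>v w) = (?D *\<^sub>v w) \<bullet>c w"
    using unitary_cscalar_prod[OF U Dw w] by simp
  then show ?thesis
    unfolding skew_part_form[OF A Uw] real_diag_form[OF w] by (simp only: of_real_eq_iff)
qed

lemma weighted_sum_ge:
  fixes d :: "nat \<Rightarrow> real" and w :: "complex vec"
  assumes w: "w \<in> carrier_vec n" "w \<bullet>c w = 1" and d: "\<And>i. i < n \<Longrightarrow> w $ i \<noteq> 0 \<Longrightarrow> c \<le> d i"
  shows "c \<le> (\<Sum>i<n. d i * (cmod (w $ i))\<^sup>2)"
proof -
  have "(\<Sum>i<n. (cmod (w $ i))\<^sup>2) = 1"
    using w by (simp only: cscalar_prod_self of_real_eq_1_iff)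
  then have "c = (\<Sum>i<n. c * (cmod (w $ i))\<^sup>2)" by (simp flip: sum_distrib_left)
  also have "\<dots> \<le> (\<Sum>i<n. d i * (cmod (w $ i))\<^sup>2)"
    using d by (intro sum_mono) (metis lessThan_iff mult_right_mono norm_zero power_zero_numeral
        mult_zero_right order_refl zero_le_power2)
  finally show ?thesis .
qed

text \<open>
  The imaginary part of the quadratic form ignores \<open>H\<close> and sees only \<open>\<langle>B\<^sup>* v, G\<^sup>* v\<rangle>\<close>. Under the
  \<open>k\<close> linear conditions \<open>B\<^sup>* v = - c G\<^sup>* v\<close> this inner product is \<open>- c \<parallel>G\<^sup>* v\<parallel>\<^sup>2\<close>, so the
  sign of \<open>Im c\<close> determines that of its imaginary part.
\<close>

lemma im_form_hermitian_plus_rank: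
  fixes c :: complex
  assumes H: "H \<in> carrier_mat n n" "hermitian_mat H"
    and G: "G \<in> carrier_mat n k" and B: "B \<in> carrier_mat n k" and v: "v \<in> carrier_vec n"
    and rel: "(mat_adjoint B + c \<cdot>\<^sub>m mat_adjoint G) *\<^sub>v v = 0\<^sub>v k"
  obtains r where "r \<ge> 0" "Im (((H + G * mat_adjoint B) *\<^sub>v v) \<bullet>c v) = - Im c * r"
proof -
  define a b where "a = mat_adjoint G *\<^sub>v v" and "b = mat_adjoint B *\<^sub>v v"
  have a: "a \<in> carrier_vec k" and b: "b \<in> carrier_vec k" 
    using mult_mat_vec_carrier[OF mat_adjoint_carrier v] G B by (simp_all add: a_def b_def)
  have "b + c \<cdot>\<^sub>v a = 0\<^sub>v k"
    using rel G B v
    by (simp add: a_def b_def add_mult_distrib_mat_vec[of _ k n] smult_mult_mat_vec[of _ k n])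
  then have b_eq: "b $ l = - c * a $ l" if "l < k" for l
  proof -
    have "(b + c \<cdot>\<^sub>v a) $ l = 0" using \<open>b + c \<cdot>\<^sub>v a = 0\<^sub>v k\<close> that by simp
    then show ?thesis using a b that by (simp add: add_eq_0_iff2)
  qed
  have "b \<bullet>c a = - c * (a \<bullet>c a)"
    using a by (simp add: cscalar_prod_eq_sum[of _ k] b_eq sum_distrib_left mult.assoc sum_negf)
  then have ba: "Im (b \<bullet>c a) = - Im c * (\<Sum>i<k. (cmod (a $ i))\<^sup>2)"
    by (simp add: cscalar_prod_self[OF a])
  have Hvc: "H *\<^sub>v v \<in> carrier_vec n" using H(1) v by (rule mult_mat_vec_carrier)
  have "(H *\<^sub>v v) \<bullet>c v = v \<bullet>c (H *\<^sub>v v)"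
    using cscalar_prod_adjoint[OF H(1) v v] H(2) by (simp only: hermitian_mat_def)
  also have "\<dots> = cnj ((H *\<^sub>v v) \<bullet>c v)" by (rule cscalar_prod_commute[OF Hvc v])
  finally have "(H *\<^sub>v v) \<bullet>c v = cnj ((H *\<^sub>v v) \<bullet>c v)" .
  then have Hv: "Im ((H *\<^sub>v v) \<bullet>c v) = 0" by (metis Reals_cnj_iff complex_is_Real_iff)
  have GB: "G * mat_adjoint B \<in> carrier_mat n n"
    using G mat_adjoint_carrier[OF B] by (rule mult_carrier_mat)
  have "(H + G * mat_adjoint B) *\<^sub>v v = H *\<^sub>v v + G *\<^sub>v b"
    unfolding b_def add_mult_distrib_mat_vec[OF H(1) GB v] assoc_mult_mat_vec[OF G mat_adjoint_carrier[OF B] v]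
    by (rule refl)
  then have "((H + G * mat_adjoint B) *\<^sub>v v) \<bullet>c v = (H *\<^sub>v v) \<bullet>c v + (G *\<^sub>v b) \<bullet>c v"
    using Hvc mult_mat_vec_carrier[OF G b] v by (simp add: add_scalar_prod_distrib[of _ n])
  also have "(G *\<^sub>v b) \<bullet>c v = b \<bullet>c a"
    unfolding a_def by (rule cscalar_prod_adjoint[OF G b v])
  finally show thesis using that[of "\<Sum>i<k. (cmod (a $ i))\<^sup>2"] Hv ba by (simp add: sum_nonneg)
qed

text \<open>
  The preceding lemma with its conditions written in the eigenbasis \<open>U\<close>, where the flags live.
\<close>

lemma hermitian_plus_rank_form_constraint:
  fixes c :: complex
  assumes X: "X \<in> hermitian_plus_rank n k" and U: "U \<in> carrier_mat n n"
  obtains C where "C \<in> carrier_mat k n"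
    "\<And>w. w \<in> carrier_vec n \<Longrightarrow> C *\<^sub>v w = 0\<^sub>v k \<Longrightarrow>
      \<exists>r\<ge>0. Im ((X *\<^sub>v (U *\<^sub>v w)) \<bullet>c (U *\<^sub>v w)) = - Im c * r"
proof -
  obtain H G B where H: "H \<in> carrier_mat n n" "hermitian_mat H"
    and G: "G \<in> carrier_mat n k" and B: "B \<in> carrier_mat n k" and X_eq: "X = H + G * mat_adjoint B"
    using X unfolding hermitian_plus_rank_def by auto
  define E where "E = mat_adjoint B + c \<cdot>\<^sub>m mat_adjoint G"
  have E: "E \<in> carrier_mat k n"
    unfolding E_def by (intro add_carrier_mat smult_carrier_mat mat_adjoint_carrier G)
  show thesis
  proof (rule that[of "E * U"])
    show "E * U \<in> carrier_mat k n" using E U by (rule mult_carrier_mat)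
    fix w :: "complex vec"
    assume w: "w \<in> carrier_vec n" and 0: "(E * U) *\<^sub>v w = 0\<^sub>v k"
    have "E *\<^sub>v (U *\<^sub>v w) = 0\<^sub>v k" using 0 assoc_mult_mat_vec[OF E U w] by simp
    then show "\<exists>r\<ge>0. Im ((X *\<^sub>v (U *\<^sub>v w)) \<bullet>c (U *\<^sub>v w)) = - Im c * r"
      using im_form_hermitian_plus_rank[OF H G B mult_mat_vec_carrier[OF U w], of c]
      unfolding E_def X_eq by metis
  qed
qed

section \<open>The lower bound on the distance\<close>

lemma hermitian_plus_rank_carrier:
  "X \<in> hermitian_plus_rank n k \<Longrightarrow> X \<in> carrier_mat n n"
  unfolding hermitian_plus_rank_def
  by (auto intro!: add_carrier_mat mult_carrier_mat[OF _ mat_adjoint_carrier])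

text \<open>
  Each summand on the left is matched with a vector of an orthonormal family on which the form of
  \<open>A - X\<close> has modulus at least \<open>\<bar>lam (Suc j)\<bar>\<close>. For a positive eigenvalue the vector lies in the
  span of the first \<open>j + 1\<close> eigenvectors, where the form of the skew part of \<open>A\<close> is at least
  \<open>lam (Suc j)\<close>; for a negative one it lies in the span of the eigenvectors from position \<open>j\<close> on.
\<close>

lemma distance_lower_bound:
  fixes lam :: "nat \<Rightarrow> real"
  assumes A: "A \<in> carrier_mat n n" and U: "U \<in> carrier_mat n n" "unitary_mat U"
    and eig: "skew_part A = U * real_diag n lam * mat_adjoint U"
    and dec: "\<And>i j. i \<le> j \<Longrightarrow> j < n \<Longrightarrow> lam (Suc j) \<le> lam (Suc i)"
    and X: "X \<in> hermitian_plus_rank n k"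
  shows "(\<Sum>j | j < n \<and> (k \<le> j \<and> 0 < lam (Suc j) \<or> j < n - k \<and> lam (Suc j) < 0). (lam (Suc j))\<^sup>2)
    \<le> (frobenius_norm (A - X))\<^sup>2"
proof -
  define J where "J = {j. j < n \<and> (k \<le> j \<and> 0 < lam (Suc j) \<or> j < n - k \<and> lam (Suc j) < 0)}"
  define q where "q M w = Im ((M *\<^sub>v (U *\<^sub>v w)) \<bullet>c (U *\<^sub>v w))" for M w
  note Xc = hermitian_plus_rank_carrier[OF X]
  \<comment> \<open>The two choices \<open>c = \<i>\<close> and \<open>c = -\<i>\<close> make the contribution of \<open>X\<close> nonpositive where
    \<open>lam\<close> is positive and nonnegative where \<open>lam\<close> is negative, so in both cases it only pushes
    the imaginary part of the form of \<open>A - X\<close> further away from zero.\<close>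
  obtain C where C: "C \<in> carrier_mat k n" and
    Cq: "\<And>w. w \<in> carrier_vec n \<Longrightarrow> C *\<^sub>v w = 0\<^sub>v k \<Longrightarrow> q X w \<le> 0"
    by (rule hermitian_plus_rank_form_constraint[OF X U(1), of \<i>]) (force simp: q_def)
  obtain C' where C': "C' \<in> carrier_mat k n" and
    Cq': "\<And>w. w \<in> carrier_vec n \<Longrightarrow> C' *\<^sub>v w = 0\<^sub>v k \<Longrightarrow> q X w \<ge> 0"
    by (rule hermitian_plus_rank_form_constraint[OF X U(1), of "- \<i>"]) (force simp: q_def)
  obtain p where p: "orthonormal_on {k..<n} n p" "\<And>j. j \<in> {k..<n} \<Longrightarrow> C *\<^sub>v p j = 0\<^sub>v k"
    "\<And>i j. j \<in> {k..<n} \<Longrightarrow> j < i \<Longrightarrow> i < n \<Longrightarrow> p j $ i = 0"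
    by (rule orthonormal_flag[OF C]) (rule that)
  obtain m where m: "orthonormal_on {..<n - k} n m" "\<And>j. j < n - k \<Longrightarrow> C' *\<^sub>v m j = 0\<^sub>v k"
    "\<And>i j. j < n - k \<Longrightarrow> i < j \<Longrightarrow> m j $ i = 0"
    by (rule orthonormal_opposite_flag[OF C']) (rule that)
  define w where "w j = (if 0 < lam (Suc j) then p j else m j)" for j
  have pc: "p j \<in> carrier_vec n" if "j \<in> {k..<n}" for j
    using p(1) that unfolding orthonormal_on_def by blast
  have mc: "m j \<in> carrier_vec n" if "j < n - k" for j
    using m(1) that unfolding orthonormal_on_def by blast
  have wc: "w j \<in> carrier_vec n" if "j \<in> J" for j
    using that pc mc by (auto simp: J_def w_def)
  \<comment> \<open>Vectors of the two families have disjoint supports, because the positive eigenvalues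
    precede the negative ones; this is the only interaction between the two signs.\<close>
  have pm: "p j \<bullet>c m l = 0" if "j \<in> J" "l \<in> J" "0 < lam (Suc j)" "lam (Suc l) < 0" for j l
  proof -
    have jl: "j < l" using dec[of l j] that by (fastforce simp: J_def)
    have "p j \<bullet>c m l = (\<Sum>i<n. p j $ i * cnj (m l $ i))"
      using that by (intro cscalar_prod_eq_sum mc) (auto simp: J_def)
    also have "\<dots> = 0"
    proof (intro sum.neutral ballI)
      fix i assume "i \<in> {..<n}"
      then show "p j $ i * cnj (m l $ i) = 0"
        using p(3)[of j i] m(3)[of l i] jl that by (cases "j < i") (auto simp: J_def)
    qed
    finally show ?thesis .
  qed
  have w_on: "w j \<bullet>c w l = (if j = l then 1 else 0)" if j: "j \<in> J" and l: "l \<in> J" for j l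
  proof -
    consider "0 < lam (Suc j)" "0 < lam (Suc l)" | "lam (Suc j) < 0" "lam (Suc l) < 0"
      | "0 < lam (Suc j)" "lam (Suc l) < 0" | "lam (Suc j) < 0" "0 < lam (Suc l)"
      using j l by (auto simp: J_def)
    then show ?thesis
    proof cases
      case 1
      then have "j \<in> {k..<n}" "l \<in> {k..<n}" using j l by (auto simp: J_def)
      with p(1) have "p j \<bullet>c p l = (if j = l then 1 else 0)" unfolding orthonormal_on_def by blast
      with 1 show ?thesis by (simp add: w_def)
    next
      case 2
      then have "j \<in> {..<n - k}" "l \<in> {..<n - k}" using j l by (auto simp: J_def)
      with m(1) have "m j \<bullet>c m l = (if j = l then 1 else 0)" unfolding orthonormal_on_def by blast
      with 2 show ?thesis by (simp add: w_def)
    next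
      case 3
      then show ?thesis using pm[OF j l] by (auto simp: w_def)
    next
      case 4
      then have "w l \<bullet>c w j = 0" using pm[OF l j] by (auto simp: w_def)
      then show ?thesis using cscalar_prod_commute[OF wc[OF l] wc[OF j]] 4 by auto
    qed
  qed
  define v where "v j = U *\<^sub>v w j" for j
  have v_on: "orthonormal_on J n v"
    using w_on wc U unfolding orthonormal_on_def v_def
    by (simp add: unitary_cscalar_prod[OF U] mult_mat_vec_carrier[OF U(1)])
  have qA: "q A x = (\<Sum>i<n. lam (Suc i) * (cmod (x $ i))\<^sup>2)" if "x \<in> carrier_vec n" for x
    unfolding q_def by (rule im_form_eigenbasis[OF A U eig that])
  have bound: "(lam (Suc j))\<^sup>2 \<le> (cmod (((A - X) *\<^sub>v v j) \<bullet>c v j))\<^sup>2" if j: "j \<in> J" for j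
  proof -
    have vj: "v j \<in> carrier_vec n" using v_on j by (simp add: orthonormal_on_def)
    have "Im (((A - X) *\<^sub>v v j) \<bullet>c v j) = q A (w j) - q X (w j)"
      using A Xc vj minus_mult_distrib_mat_vec[OF A Xc vj]
      by (simp add: q_def flip: v_def) (simp add: minus_scalar_prod_distrib[of _ n])
    moreover have "\<bar>lam (Suc j)\<bar> \<le> \<bar>q A (w j) - q X (w j)\<bar>"
    proof (cases "0 < lam (Suc j)")
      case True
      then have jk: "j \<in> {k..<n}" and wj: "w j = p j" using j by (auto simp: J_def w_def)
      have "lam (Suc j) \<le> q A (w j)"
        unfolding qA[OF wc[OF j]]
      proof (rule weighted_sum_ge[OF wc[OF j]])
        show "w j \<bullet>c w j = 1" using w_on[OF j j] by simp
        show "lam (Suc j) \<le> lam (Suc i)" if "i < n" "w j $ i \<noteq> 0" for i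
          using dec[of i j] p(3)[OF jk, of i] that jk wj by (cases "j < i") auto
      qed
      moreover have "q X (w j) \<le> 0" using Cq[OF pc[OF jk] p(2)[OF jk]] wj by simp
      ultimately show ?thesis using True by simp
    next
      case False
      then have jk: "j < n - k" and neg: "lam (Suc j) < 0" and wj: "w j = m j"
        using j by (auto simp: J_def w_def)
      have "- lam (Suc j) \<le> (\<Sum>i<n. - lam (Suc i) * (cmod (w j $ i))\<^sup>2)"
      proof (rule weighted_sum_ge[OF wc[OF j]])
        show "w j \<bullet>c w j = 1" using w_on[OF j j] by simp
        show "- lam (Suc j) \<le> - lam (Suc i)" if "i < n" "w j $ i \<noteq> 0" for i
          using dec[of j i] m(3)[OF jk, of i] that wj by (cases "i < j") auto
      qed
      also have "\<dots> = - q A (w j)" by (simp add: qA[OF wc[OF j]] sum_negf)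
      finally have "q A (w j) \<le> lam (Suc j)" by simp
      moreover have "q X (w j) \<ge> 0" using Cq'[OF mc[OF jk] m(2)[OF jk]] wj by simp
      ultimately show ?thesis using neg by simp
    qed
    ultimately have "\<bar>lam (Suc j)\<bar> \<le> cmod (((A - X) *\<^sub>v v j) \<bullet>c v j)"
      using abs_Im_le_cmod order_trans by metis
    then show ?thesis by (metis abs_ge_zero power2_abs power_mono)
  qed
  have "(\<Sum>j\<in>J. (lam (Suc j))\<^sup>2) \<le> (\<Sum>j\<in>J. (cmod (((A - X) *\<^sub>v v j) \<bullet>c v j))\<^sup>2)"
    by (rule sum_mono[OF bound])
  also have "\<dots> \<le> (frobenius_norm (A - X))\<^sup>2"
    using minus_carrier_mat[OF Xc] by (intro sum_forms_le_frobenius[OF _ _ v_on]) (auto simp: J_def)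
  finally show ?thesis unfolding J_def .
qed

section \<open>Constructing Hermitian-plus-rank-k matrices\<close>

lemma hermitian_if_same_skew:
  fixes X P :: "complex mat"
  assumes X: "X \<in> carrier_mat n n" and P: "P \<in> carrier_mat n n"
    and eq: "X - mat_adjoint X = P - mat_adjoint P"
  shows "hermitian_mat (X - P)"
  unfolding hermitian_mat_def
proof (rule eq_matI)
  fix i j assume "i < dim_row (X - P)" "j < dim_col (X - P)"
  then have ij: "i < n" "j < n" using P by auto
  have "(X - mat_adjoint X) $$ (i, j) = (P - mat_adjoint P) $$ (i, j)" using eq by simp
  then have "X $$ (i, j) - cnj (X $$ (j, i)) = P $$ (i, j) - cnj (P $$ (j, i))"
    by (simp only: minus_adjoint_index[OF X ij] minus_adjoint_index[OF P ij])
  then show "mat_adjoint (X - P) $$ (i, j) = (X - P) $$ (i, j)"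
    using ij X P by (simp add: algebra_simps)
qed (use X P in auto)

text \<open>
  Membership depends on the skew part alone: whatever is left after removing a matrix of rank
  at most \<open>k\<close> with the same skew part is Hermitian.
\<close>

lemma hermitian_plus_rankI:
  assumes X: "X \<in> carrier_mat n n" and G: "G \<in> carrier_mat n k" and B: "B \<in> carrier_mat n k"
    and eq: "X - mat_adjoint X = G * mat_adjoint B - mat_adjoint (G * mat_adjoint B)"
  shows "X \<in> hermitian_plus_rank n k"
proof -
  let ?P = "G * mat_adjoint B"
  have P: "?P \<in> carrier_mat n n" using G mat_adjoint_carrier[OF B] by (rule mult_carrier_mat)
  have "X = (X - ?P) + ?P" using X P by (intro eq_matI) auto
  with hermitian_if_same_skew[OF X P eq] minus_carrier_mat[OF P] G B show ?thesis
    unfolding hermitian_plus_rank_def by blast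
qed

text \<open>
  A real diagonal matrix \<open>\<Delta>\<close> whose positive entries are among the first \<open>k\<close> and whose
  negative entries are among the last \<open>k\<close> is the skew part of a matrix of rank at most \<open>k\<close>,
  although its own rank may be \<open>2 k\<close>. With \<open>\<Delta> = R R\<^sup>T - T T\<^sup>T\<close> the product \<open>\<i> (R + T) (R - T)\<^sup>T\<close> differs from \<open>\<i> \<Delta>\<close> by
  \<open>\<i> (T R\<^sup>T - R T\<^sup>T)\<close>, which is Hermitian.
\<close>

lemma real_diag_skew_factorization:
  fixes d :: "nat \<Rightarrow> real"
  assumes pos: "\<And>i. i < n \<Longrightarrow> 0 < d (Suc i) \<Longrightarrow> i < k"
    and neg: "\<And>i. i < n \<Longrightarrow> d (Suc i) < 0 \<Longrightarrow> n - Suc i < k"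
  obtains G B where "G \<in> carrier_mat n k" "B \<in> carrier_mat n k"
    "G * mat_adjoint B - mat_adjoint (G * mat_adjoint B) = (2 * \<i>) \<cdot>\<^sub>m real_diag n d"
proof -
  \<comment> \<open>\<open>R\<close> and \<open>T\<close> are square roots of the positive and negative parts of the diagonal matrix
    \<open>\<Delta>\<close>, squeezed into \<open>k\<close> columns, so that \<open>R R\<^sup>T - T T\<^sup>T = \<Delta>\<close>. The mirrored column index in \<open>T\<close>
    brings the last \<open>k\<close> positions into the range \<open>0..<k\<close>.\<close>
  define R where "R a l = (if l = a \<and> 0 < d (Suc a) then sqrt (d (Suc a)) else 0)" for a l
  define T where "T a l = (if l = n - Suc a \<and> d (Suc a) < 0 then sqrt (- d (Suc a)) else 0)" for a l
  define G where "G = mat n k (\<lambda>(a, l). \<i> * complex_of_real (R a l + T a l))"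
  define B where "B = mat n k (\<lambda>(a, l). complex_of_real (R a l - T a l))"
  let ?P = "G * mat_adjoint B"
  have G: "G \<in> carrier_mat n k" and B: "B \<in> carrier_mat n k" by (simp_all add: G_def B_def)
  have P: "?P \<in> carrier_mat n n" using G mat_adjoint_carrier[OF B] by (rule mult_carrier_mat)
  have entry: "?P $$ (a, b) = \<i> * complex_of_real (\<Sum>l<k. (R a l + T a l) * (R b l - T b l))"
    if "a < n" "b < n" for a b
    using that
    by (subst mult_mat_index_sum[OF G mat_adjoint_carrier[OF B]])
       (simp_all add: G_def B_def sum_distrib_left mult.assoc)
  have RR: "(\<Sum>l<k. R a l * R b l) = (if a = b then max 0 (d (Suc a)) else 0)" if "a < n" "b < n" for a b
  proof -
    have "(\<Sum>l<k. R a l * R b l) = (\<Sum>l<k. if l = a then (if a = b then max 0 (d (Suc a)) else 0) else 0)"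
      by (intro sum.cong refl) (auto simp: R_def)
    then show ?thesis using pos[OF that(1)] by (simp only: sum.delta finite_lessThan lessThan_iff) (force simp: max_def order_le_less)
  qed
  have TT: "(\<Sum>l<k. T a l * T b l) = (if a = b then max 0 (- d (Suc a)) else 0)" if "a < n" "b < n" for a b
  proof -
    have "(\<Sum>l<k. T a l * T b l)
        = (\<Sum>l<k. if l = n - Suc a then (if a = b then max 0 (- d (Suc a)) else 0) else 0)"
      using that by (intro sum.cong refl) (auto simp: T_def)
    then show ?thesis using neg[OF that(1)] by (simp only: sum.delta finite_lessThan lessThan_iff) (force simp: max_def order_le_less)
  qed
  have "?P - mat_adjoint ?P = (2 * \<i>) \<cdot>\<^sub>m real_diag n d"
  proof (rule eq_matI)
    fix a b assume "a < dim_row ((2 * \<i>) \<cdot>\<^sub>m real_diag n d)" "b < dim_col ((2 * \<i>) \<cdot>\<^sub>m real_diag n d)"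
    then have ab: "a < n" "b < n" using carrier_matD[OF real_diag_carrier[of n d]] by auto
    have "(\<Sum>l<k. (R a l + T a l) * (R b l - T b l)) + (\<Sum>l<k. (R b l + T b l) * (R a l - T a l))
        = 2 * ((\<Sum>l<k. R a l * R b l) - (\<Sum>l<k. T a l * T b l))"
      by (simp add: sum_distrib_left algebra_simps flip: sum.distrib sum_subtractf)
    also have "\<dots> = 2 * (if a = b then d (Suc a) else 0)"
      using RR[OF ab] TT[OF ab] by (auto simp: max_def)
    finally have "(?P - mat_adjoint ?P) $$ (a, b) = \<i> * complex_of_real (2 * (if a = b then d (Suc a) else 0))"
      unfolding minus_adjoint_index[OF P ab] entry[OF ab] entry[OF ab(2,1)]
      by (simp del: of_real_sum of_real_mult flip: distrib_left of_real_add)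
    then show "(?P - mat_adjoint ?P) $$ (a, b) = ((2 * \<i>) \<cdot>\<^sub>m real_diag n d) $$ (a, b)"
      using ab carrier_matD[OF real_diag_carrier[of n d]] by (simp add: real_diag_index del: index_mult_mat(1))
  qed (use P carrier_matD[OF real_diag_carrier[of n d]] in auto)
  then show thesis by (rule that[OF G B])
qed

lemma hermitian_plus_rank_if_inertia:
  fixes d :: "nat \<Rightarrow> real"
  assumes X: "X \<in> carrier_mat n n" and U: "U \<in> carrier_mat n n"
    and skew: "X - mat_adjoint X = (2 * \<i>) \<cdot>\<^sub>m (U * real_diag n d * mat_adjoint U)"
    and pos: "\<And>i. i < n \<Longrightarrow> 0 < d (Suc i) \<Longrightarrow> i < k"
    and neg: "\<And>i. i < n \<Longrightarrow> d (Suc i) < 0 \<Longrightarrow> n - Suc i < k"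
  shows "X \<in> hermitian_plus_rank n k"
proof -
  obtain G B where G: "G \<in> carrier_mat n k" and B: "B \<in> carrier_mat n k"
    and GB: "G * mat_adjoint B - mat_adjoint (G * mat_adjoint B) = (2 * \<i>) \<cdot>\<^sub>m real_diag n d"
    using real_diag_skew_factorization[of n d k] pos neg by metis
  note U' = mat_adjoint_carrier[OF U] and B' = mat_adjoint_carrier[OF B]
  have Q: "G * mat_adjoint B \<in> carrier_mat n n" by (rule mult_carrier_mat[OF G B'])
  have "(U * G) * mat_adjoint (U * B) = U * (G * mat_adjoint B) * mat_adjoint U"
    using U U' G B' Q
    by (simp only: mat_adjoint_mult[OF U B] assoc_mult_mat[OF U G B', symmetric]
        assoc_mult_mat[OF mult_carrier_mat[OF U G] B' U'])
  then have "(U * G) * mat_adjoint (U * B) - mat_adjoint ((U * G) * mat_adjoint (U * B))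
      = U * ((2 * \<i>) \<cdot>\<^sub>m real_diag n d) * mat_adjoint U"
    by (simp only: congruence_minus_adjoint[OF U Q] GB)
  also have "\<dots> = (2 * \<i>) \<cdot>\<^sub>m (U * real_diag n d * mat_adjoint U)"
    by (simp only: mult_smult_distrib[OF U real_diag_carrier]
        mult_smult_assoc_mat[OF mult_carrier_mat[OF U real_diag_carrier] U'])
  finally show ?thesis
    by (intro hermitian_plus_rankI[OF X mult_carrier_mat[OF U G] mult_carrier_mat[OF U B]])
       (simp only: skew)
qed

section \<open>The nearest Hermitian-plus-rank-k matrix\<close>

theorem theorem15:
  fixes n k kp km :: nat
    and A U D Dhat Ahat :: "complex mat"
    and lam dhat :: "nat \<Rightarrow> real"
  assumes A: "A \<in> carrier_mat n n"
    and k: "k \<le> n"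
    and U: "U \<in> carrier_mat n n" "unitary_mat U"
    and D: "D = real_diag n lam"
    and eigendecomposition: "skew_part A = U * D * mat_adjoint U"
    and ordered: "\<forall>i\<in>{1..n}. \<forall>j\<in>{1..n}. i \<le> j \<longrightarrow> lam j \<le> lam i"
    and kp: "kp = card {i\<in>{1..n}. lam i > 0}"
    and km: "km = card {i\<in>{1..n}. lam i < 0}"
    and dhat: "\<forall>i\<in>{1..n}. dhat i =
          (if (k < i \<and> i \<le> kp) \<or> (n - km < i \<and> i \<le> n - k) then 0 else lam i)"
    and Dhat: "Dhat = real_diag n dhat"
    and Ahat: "Ahat = A - \<i> \<cdot>\<^sub>m (U * (D - Dhat) * mat_adjoint U)"
  shows "Ahat \<in> hermitian_plus_rank n k \<and>
    (\<forall>X\<in>hermitian_plus_rank n k. frobenius_norm (A - Ahat) \<le> frobenius_norm (A - X))"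
proof -
  \<comment> \<open>\<open>J\<close> collects the discarded eigenvalues by matrix position, counted from \<open>0\<close>; by the sign
    pattern of \<open>lam\<close> its two parts are the two index ranges that \<open>k\<close>, \<open>kp\<close> and \<open>km\<close> describe.\<close>
  define J where "J = {j. j < n \<and> (k \<le> j \<and> 0 < lam (Suc j) \<or> j < n - k \<and> lam (Suc j) < 0)}"
  define e where "e i = lam i - dhat i" for i
  define M where "M d = U * real_diag n d * mat_adjoint U" for d
  have dhat_eq: "dhat (Suc j) = (if j \<in> J then 0 else lam (Suc j))" if "j < n" for j
  proof -
    have j: "Suc j \<in> {1..n}" using that by simp
    from dhat sign_pattern[OF ordered kp km j] j that show ?thesis by (auto simp: J_def)
  qed
  have M: "M d \<in> carrier_mat n n" for d
    unfolding M_def using U(1) mat_adjoint_carrier[OF U(1)] real_diag_carrier by (intro mult_carrier_mat)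
  have M_index: "M d $$ (a, b) = (\<Sum>j<n. of_real (d (Suc j)) * (U $$ (a, j) * cnj (U $$ (b, j))))"
    if "a < n" "b < n" for a b d
    unfolding M_def by (rule congruence_diag_index[OF U(1) that])
  have "D - Dhat = real_diag n e"
    unfolding D Dhat
    by (intro eq_matI)
       (auto simp: real_diag_index e_def carrier_matD[OF real_diag_carrier[of n]])
  then have Ahat_eq: "Ahat = A - \<i> \<cdot>\<^sub>m M e" by (simp only: Ahat M_def)
  have Ahat_c: "Ahat \<in> carrier_mat n n"
    unfolding Ahat_eq by (intro minus_carrier_mat smult_carrier_mat M)
  have "Ahat - mat_adjoint Ahat = (2 * \<i>) \<cdot>\<^sub>m M dhat"
  proof (rule eq_matI)
    fix a b assume "a < dim_row ((2 * \<i>) \<cdot>\<^sub>m M dhat)" "b < dim_col ((2 * \<i>) \<cdot>\<^sub>m M dhat)"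
    then have ab: "a < n" "b < n" using M[of dhat] by auto
    \<comment> \<open>As \<open>M e\<close> is Hermitian, subtracting \<open>\<i> M e\<close> leaves the Hermitian part of \<open>A\<close> alone and
      replaces \<open>lam\<close> by \<open>dhat\<close> in the skew part.\<close>
    have M_herm: "cnj (M e $$ (b, a)) = M e $$ (a, b)"
      by (simp add: M_index ab mult.commute)
    have M_diff: "M lam $$ (a, b) - M e $$ (a, b) = M dhat $$ (a, b)"
      by (simp add: M_index ab e_def algebra_simps flip: sum_subtractf)
    have "(A - mat_adjoint A) $$ (a, b) = ((2 * \<i>) \<cdot>\<^sub>m M lam) $$ (a, b)"
      using minus_adjoint_eq_skew_part[OF A] eigendecomposition by (simp only: D M_def)
    then have A_skew: "A $$ (a, b) - cnj (A $$ (b, a)) = 2 * \<i> * M lam $$ (a, b)"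
      using M[of lam] ab by (simp only: minus_adjoint_index[OF A ab]) simp
    have Ahat_index: "Ahat $$ (a, b) = A $$ (a, b) - \<i> * M e $$ (a, b)"
      "Ahat $$ (b, a) = A $$ (b, a) - \<i> * M e $$ (b, a)"
      unfolding Ahat_eq using A M[of e] ab by simp_all
    have "(Ahat - mat_adjoint Ahat) $$ (a, b)
        = A $$ (a, b) - cnj (A $$ (b, a)) - 2 * \<i> * M e $$ (a, b)"
      unfolding minus_adjoint_index[OF Ahat_c ab] Ahat_index by (simp add: M_herm)
    also have "\<dots> = 2 * \<i> * M dhat $$ (a, b)"
      unfolding A_skew M_diff[symmetric] by (simp add: algebra_simps)
    finally show "(Ahat - mat_adjoint Ahat) $$ (a, b) = ((2 * \<i>) \<cdot>\<^sub>m M dhat) $$ (a, b)"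
      using M[of dhat] ab by simp
  qed (use M[of dhat] Ahat_c in auto)
  then have mem: "Ahat \<in> hermitian_plus_rank n k"
    unfolding M_def
    by (rule hermitian_plus_rank_if_inertia[OF Ahat_c U(1)])
       (auto simp: dhat_eq J_def split: if_splits)
  have "A - Ahat = \<i> \<cdot>\<^sub>m M e"
    unfolding Ahat_eq using A M[of e] by (intro eq_matI) auto
  then have "(frobenius_norm (A - Ahat))\<^sup>2 = (\<Sum>j<n. (e (Suc j))\<^sup>2)"
    using frobenius_norm_congruence_diag[OF U, of e] by (simp add: frobenius_norm_smult M_def)
  also have "\<dots> = (\<Sum>j<n. if j \<in> J then (lam (Suc j))\<^sup>2 else 0)"
    by (intro sum.cong refl) (simp add: e_def dhat_eq)
  also have "\<dots> = (\<Sum>j\<in>J. (lam (Suc j))\<^sup>2)"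
    by (subst sum.inter_restrict[symmetric]) (auto simp: J_def intro!: sum.cong)
  finally have dist: "(frobenius_norm (A - Ahat))\<^sup>2 = (\<Sum>j\<in>J. (lam (Suc j))\<^sup>2)" .
  have "frobenius_norm (A - Ahat) \<le> frobenius_norm (A - X)" if X: "X \<in> hermitian_plus_rank n k" for X
  proof (rule power2_le_imp_le)
    have "lam (Suc j) \<le> lam (Suc i)" if "i \<le> j" "j < n" for i j
      using ordered that by simp
    then show "(frobenius_norm (A - Ahat))\<^sup>2 \<le> (frobenius_norm (A - X))\<^sup>2"
      unfolding dist J_def
      using eigendecomposition D by (intro distance_lower_bound[OF A U _ _ X]) auto
    show "0 \<le> frobenius_norm (A - X)"
      by (simp add: frobenius_norm_def sum_nonneg)
  qed
  with mem show ?thesis by blast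
qed

end
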